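(* Up to isomorphism, there is exactly one amiable semigroup of order $4$ which is not adequate.
   Context: For a semigroup $S$, $S^1$ denotes $S$ with an identity element adjoined if necessary ($S^1=S$ if $S$ already has an identity). For $s,t\in S$: $s\,\mathcal{L}^*\,t$ if and only if for all $x,y\in S^1$, $sx=sy\Leftrightarrow tx=ty$; and $s\,\mathcal{R}^*\,t$ if and only if for all $x,y\in S^1$, $xs=ys\Leftrightarrow xt=yt$. These are equivalence relations on $S$. A semigroup is abundant if each $\mathcal{L}^*$-class and each $\mathcal{R}^*$-class contains at least one idempotent. A semigroup is adequate if it is abundant and its idempotents commute. A semigroup is amiable if each $\mathcal{R}^*$-class and each $\mathcal{L}^*$-class contains a unique idempotent. *)

theory Defs
  imports "HOL-Algebra.Coset"
begin

text \<open>
  A semigroup is carried by the record type of HOL-Algebra, so that \<open>\<otimes>\<close>, \<open>hom\<close>, \<open>iso\<close>, \<open>\<cong>\<close> and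
  \<open>order\<close> apply to it.  The field \<open>one\<close> of the record is unconstrained and never inspected:
  \<open>hom\<close>, \<open>\<cong>\<close> and all definitions below depend on the carrier and the multiplication only.
\<close>

locale semigroup_struct =
  fixes S (structure)
  assumes m_closed: "\<lbrakk>x \<in> carrier S; y \<in> carrier S\<rbrakk> \<Longrightarrow> x \<otimes> y \<in> carrier S"
    and m_assoc: "\<lbrakk>x \<in> carrier S; y \<in> carrier S; z \<in> carrier S\<rbrakk>
      \<Longrightarrow> (x \<otimes> y) \<otimes> z = x \<otimes> (y \<otimes> z)"

definition is_identity :: "('a, 'b) monoid_scheme \<Rightarrow> 'a \<Rightarrow> bool" where
  "is_identity S e \<longleftrightarrow> e \<in> carrier S \<and> (\<forall>x\<in>carrier S. e \<otimes>\<^bsub>S\<^esub> x = x \<and> x \<otimes>\<^bsub>S\<^esub> e = x)"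

definition has_identity :: "('a, 'b) monoid_scheme \<Rightarrow> bool" where
  "has_identity S \<longleftrightarrow> (\<exists>e. is_identity S e)"

fun option_mult :: "('a \<Rightarrow> 'a \<Rightarrow> 'a) \<Rightarrow> 'a option \<Rightarrow> 'a option \<Rightarrow> 'a option" where
  "option_mult f None y = y"
| "option_mult f x None = x"
| "option_mult f (Some a) (Some b) = Some (f a b)"

text \<open>
  The monoid \<open>S\<^sup>1\<close>.  An element \<open>s\<close> of \<open>S\<close> appears as \<open>Some s\<close>; \<open>None\<close> is the adjoined
  identity and belongs to the carrier only if \<open>S\<close> has no identity of its own.
\<close>

definition adjoin_one :: "('a, 'b) monoid_scheme \<Rightarrow> 'a option monoid" where
  "adjoin_one S =
    \<lparr>carrier = (if has_identity S then Some ` carrier S else insert None (Some ` carrier S)),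
     mult = option_mult (mult S),
     one = (if has_identity S then Some (THE e. is_identity S e) else None)\<rparr>"

definition Lstar :: "('a, 'b) monoid_scheme \<Rightarrow> ('a \<times> 'a) set" where
  "Lstar S = {(s, t). s \<in> carrier S \<and> t \<in> carrier S \<and>
    (\<forall>x\<in>carrier (adjoin_one S). \<forall>y\<in>carrier (adjoin_one S).
      Some s \<otimes>\<^bsub>adjoin_one S\<^esub> x = Some s \<otimes>\<^bsub>adjoin_one S\<^esub> y \<longleftrightarrow>
      Some t \<otimes>\<^bsub>adjoin_one S\<^esub> x = Some t \<otimes>\<^bsub>adjoin_one S\<^esub> y)}"

definition Rstar :: "('a, 'b) monoid_scheme \<Rightarrow> ('a \<times> 'a) set" where
  "Rstar S = {(s, t). s \<in> carrier S \<and> t \<in> carrier S \<and>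
    (\<forall>x\<in>carrier (adjoin_one S). \<forall>y\<in>carrier (adjoin_one S).
      x \<otimes>\<^bsub>adjoin_one S\<^esub> Some s = y \<otimes>\<^bsub>adjoin_one S\<^esub> Some s \<longleftrightarrow>
      x \<otimes>\<^bsub>adjoin_one S\<^esub> Some t = y \<otimes>\<^bsub>adjoin_one S\<^esub> Some t)}"

definition idempotents :: "('a, 'b) monoid_scheme \<Rightarrow> 'a set" where
  "idempotents S = {e \<in> carrier S. e \<otimes>\<^bsub>S\<^esub> e = e}"

locale abundant_semigroup = semigroup_struct +
  assumes Lstar_idempotent: "C \<in> carrier S // Lstar S \<Longrightarrow> \<exists>e. e \<in> C \<and> e \<in> idempotents S"
    and Rstar_idempotent: "C \<in> carrier S // Rstar S \<Longrightarrow> \<exists>e. e \<in> C \<and> e \<in> idempotents S"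

locale adequate_semigroup = abundant_semigroup +
  assumes idempotents_commute:
    "\<lbrakk>e \<in> idempotents S; f \<in> idempotents S\<rbrakk> \<Longrightarrow> e \<otimes> f = f \<otimes> e"

locale amiable_semigroup = semigroup_struct +
  assumes Rstar_unique_idempotent: "C \<in> carrier S // Rstar S \<Longrightarrow> \<exists>!e. e \<in> C \<and> e \<in> idempotents S"
    and Lstar_unique_idempotent: "C \<in> carrier S // Lstar S \<Longrightarrow> \<exists>!e. e \<in> C \<and> e \<in> idempotents S"

lemma equiv_Lstar: "equiv (carrier S) (Lstar S)"
  by (rule equivI) (auto simp: Lstar_def refl_on_def sym_def trans_def)

lemma equiv_Rstar: "equiv (carrier S) (Rstar S)"
  by (rule equivI) (auto simp: Rstar_def refl_on_def sym_def trans_def)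

lemma (in semigroup_struct) the_identity:
  assumes "is_identity S e"
  shows "(THE e. is_identity S e) = e"
  using assms by (intro the_equality) (metis is_identity_def)+

lemma (in semigroup_struct) monoid_adjoin_one: "monoid (adjoin_one S)"
proof (cases "has_identity S")
  case True
  then obtain e where e: "is_identity S e"
    by (auto simp: has_identity_def)
  show ?thesis
    by unfold_locales
      (use True e in \<open>auto simp: adjoin_one_def the_identity[OF e] m_closed m_assoc
        is_identity_def\<close>)
next
  case False
  then show ?thesis
    by unfold_locales (auto simp: adjoin_one_def m_closed m_assoc)
qed

end

theory Submission
  imports Defs
begin

text \<open>
  Green's relation \<open>\<L>\<close> is contained in \<open>\<L>\<^sup>*\<close>, and dually for \<open>\<R>\<close>, so an amiable semigroup
  contains no left zero pair \<open>x y = x\<close>, \<open>y x = y\<close> and no right zero pair of distinct elements.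
  This alone forces the multiplication.  An amiable semigroup is abundant, so it fails to be
  adequate only if two idempotents \<open>e\<close>, \<open>f\<close> do not commute.  Each of the equations \<open>ef = e\<close> and
  \<open>ef = f\<close> makes \<open>fe\<close> an idempotent forming a zero pair with \<open>e\<close> or \<open>f\<close>, whence \<open>ef = fe\<close>.
  Therefore \<open>e\<close>, \<open>f\<close>, \<open>ef\<close>, \<open>fe\<close> are four distinct elements, and in order \<open>4\<close> they are everything.

  It remains to locate \<open>efe\<close> and \<open>fef\<close>.  Either one equals \<open>ef\<close> or \<open>fe\<close>, since the values \<open>e\<close> and
  \<open>f\<close> lead back to the excluded equations.  If \<open>efe \<noteq> fef\<close>, then \<open>ef\<close> and \<open>fe\<close> are a left zero or a
  right zero pair.  So \<open>efe = fef\<close>, and up to exchanging \<open>e\<close> and \<open>f\<close> this element is \<open>ef\<close>, which is then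
  a zero.  The semigroup is generated by two idempotents with \<open>ef = 0\<close>, and its remaining element
  \<open>fe\<close> is non-zero with square \<open>0\<close>.  This semigroup is indeed amiable: \<open>fe\<close> is \<open>\<L>\<^sup>*\<close>-related to \<open>e\<close> and
  \<open>\<R>\<^sup>*\<close>-related to \<open>f\<close>, and there are no further coincidences.
\<close>

section \<open>Zero pairs in amiable semigroups\<close>

text \<open>
  The inclusion \<open>\<L> \<subseteq> \<L>\<^sup>*\<close>: multiplying \<open>s x = s y\<close> by \<open>u\<close> on the left gives \<open>t x = t y\<close>.  The two
  multiplications associate even when \<open>x\<close> or \<open>y\<close> is the adjoined identity, because \<open>S\<^sup>1\<close> is a monoid.
\<close>

lemma (in semigroup_struct) Lstar_if_mutual_left_multiples:
  assumes S: "s \<in> carrier S" "t \<in> carrier S" "u \<in> carrier S" "v \<in> carrier S"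
    and t: "t = u \<otimes> s" and s: "s = v \<otimes> t"
  shows "(s, t) \<in> Lstar S"
proof -
  interpret M: monoid "adjoin_one S" by (rule monoid_adjoin_one)
  have Some_in: "Some z \<in> carrier (adjoin_one S)" if "z \<in> carrier S" for z
    using that by (simp add: adjoin_one_def)
  have Some_mult: "Some (y \<otimes> z) = Some y \<otimes>\<^bsub>adjoin_one S\<^esub> Some z" for y z
    by (simp add: adjoin_one_def)
  have assoc: "Some (y \<otimes> z) \<otimes>\<^bsub>adjoin_one S\<^esub> x = Some y \<otimes>\<^bsub>adjoin_one S\<^esub> (Some z \<otimes>\<^bsub>adjoin_one S\<^esub> x)"
    if "y \<in> carrier S" "z \<in> carrier S" "x \<in> carrier (adjoin_one S)" for x y z
    unfolding Some_mult using that by (intro M.m_assoc Some_in)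
  show ?thesis
    unfolding Lstar_def using S assoc[OF S(3,1), folded t] assoc[OF S(4,2), folded s]
    by (simp, metis)
qed

lemma (in semigroup_struct) Rstar_if_mutual_right_multiples:
  assumes S: "s \<in> carrier S" "t \<in> carrier S" "u \<in> carrier S" "v \<in> carrier S"
    and t: "t = s \<otimes> u" and s: "s = t \<otimes> v"
  shows "(s, t) \<in> Rstar S"
proof -
  interpret M: monoid "adjoin_one S" by (rule monoid_adjoin_one)
  have Some_in: "Some z \<in> carrier (adjoin_one S)" if "z \<in> carrier S" for z
    using that by (simp add: adjoin_one_def)
  have Some_mult: "Some (y \<otimes> z) = Some y \<otimes>\<^bsub>adjoin_one S\<^esub> Some z" for y z
    by (simp add: adjoin_one_def)
  have assoc: "x \<otimes>\<^bsub>adjoin_one S\<^esub> Some (y \<otimes> z) = (x \<otimes>\<^bsub>adjoin_one S\<^esub> Some y) \<otimes>\<^bsub>adjoin_one S\<^esub> Some z"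
    if "y \<in> carrier S" "z \<in> carrier S" "x \<in> carrier (adjoin_one S)" for x y z
    unfolding Some_mult using that by (intro M.m_assoc[symmetric] Some_in)
  show ?thesis
    unfolding Rstar_def using S assoc[OF S(1,3), folded t] assoc[OF S(2,4), folded s]
    by (simp, metis)
qed

context amiable_semigroup
begin

lemma Lstar_idempotents_eq:
  assumes "(e, f) \<in> Lstar S" "e \<in> idempotents S" "f \<in> idempotents S"
  shows "e = f"
proof -
  have "e \<in> carrier S" using assms(2) by (simp add: idempotents_def)
  then have "Lstar S `` {e} \<in> carrier S // Lstar S" "e \<in> Lstar S `` {e}"
    using quotientI equiv_class_self[OF equiv_Lstar] by metis+
  with Lstar_unique_idempotent assms show ?thesis by blast
qed

lemma Rstar_idempotents_eq:
  assumes "(e, f) \<in> Rstar S" "e \<in> idempotents S" "f \<in> idempotents S"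
  shows "e = f"
proof -
  have "e \<in> carrier S" using assms(2) by (simp add: idempotents_def)
  then have "Rstar S `` {e} \<in> carrier S // Rstar S" "e \<in> Rstar S `` {e}"
    using quotientI equiv_class_self[OF equiv_Rstar] by metis+
  with Rstar_unique_idempotent assms show ?thesis by blast
qed

text \<open>
  The members of a zero pair are automatically idempotent: \<open>x x = (x y) x = x (y x) = x y = x\<close>
  for a left zero pair.
\<close>

lemma left_zero_pair_eq:
  assumes "x \<in> carrier S" "y \<in> carrier S" "x \<otimes> y = x" "y \<otimes> x = y"
  shows "x = y"
proof (rule Lstar_idempotents_eq)
  show "(x, y) \<in> Lstar S"
    using assms by (intro Lstar_if_mutual_left_multiples[of x y y x]) auto
  show "x \<in> idempotents S" "y \<in> idempotents S"
    using assms m_assoc[of x y x] m_assoc[of y x y] by (auto simp: idempotents_def)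
qed

lemma right_zero_pair_eq:
  assumes "x \<in> carrier S" "y \<in> carrier S" "x \<otimes> y = y" "y \<otimes> x = x"
  shows "x = y"
proof (rule Rstar_idempotents_eq)
  show "(x, y) \<in> Rstar S"
    using assms by (intro Rstar_if_mutual_right_multiples[of x y y x]) auto
  show "x \<in> idempotents S" "y \<in> idempotents S"
    using assms m_assoc[of x y x] m_assoc[of y x y] by (auto simp: idempotents_def)
qed

text \<open>
  If \<open>ef = e\<close>, then \<open>e (fe) = e\<close> and \<open>(fe) e = fe\<close> make \<open>e\<close> and \<open>fe\<close> a left zero pair.  If \<open>ef = f\<close>,
  then \<open>f\<close> and \<open>fe\<close> are likewise a right zero pair.
\<close>

lemma product_of_noncommuting_idempotents:
  assumes "e \<in> idempotents S" "f \<in> idempotents S" "e \<otimes> f \<noteq> f \<otimes> e"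
  shows "e \<otimes> f \<noteq> e" "e \<otimes> f \<noteq> f"
proof -
  have ef: "e \<in> carrier S" "f \<in> carrier S" "e \<otimes> e = e" "f \<otimes> f = f"
    using assms by (auto simp: idempotents_def)
  then have fe: "f \<otimes> e \<in> carrier S" by (simp add: m_closed)
  show "e \<otimes> f \<noteq> e"
  proof
    assume *: "e \<otimes> f = e"
    have "e = f \<otimes> e"
      by (rule left_zero_pair_eq) (use * ef fe m_assoc[of e f e] m_assoc[of f e e] in auto)
    with * assms(3) show False by simp
  qed
  show "e \<otimes> f \<noteq> f"
  proof
    assume *: "e \<otimes> f = f"
    have "f = f \<otimes> e"
      by (rule right_zero_pair_eq) (use * ef fe m_assoc[of f e f] m_assoc[of f f e] in auto)
    with * assms(3) show False by simp
  qed
qed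

lemma sandwich_of_noncommuting_idempotents:
  assumes "e \<in> idempotents S" "f \<in> idempotents S" "e \<otimes> f \<noteq> f \<otimes> e"
  shows "e \<otimes> (f \<otimes> e) \<noteq> e" "e \<otimes> (f \<otimes> e) \<noteq> f"
proof -
  have ef: "e \<in> carrier S" "f \<in> carrier S" "e \<otimes> e = e" "f \<otimes> f = f"
    using assms by (auto simp: idempotents_def)
  then have fe: "f \<otimes> e \<in> carrier S" by (simp add: m_closed)
  show "e \<otimes> (f \<otimes> e) \<noteq> e"
  proof
    assume *: "e \<otimes> (f \<otimes> e) = e"
    have "e = f \<otimes> e"
      by (rule left_zero_pair_eq) (use * ef fe m_assoc[of f e e] in auto)
    with product_of_noncommuting_idempotents(2)[OF assms(2,1)] assms(3) show False by simp
  qed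
  show "e \<otimes> (f \<otimes> e) \<noteq> f"
  proof
    assume *: "e \<otimes> (f \<otimes> e) = f"
    have "e \<otimes> f = f"
      using ef fe m_assoc[of e e "f \<otimes> e"] by (simp add: *)
    with product_of_noncommuting_idempotents(2)[OF assms] show False by simp
  qed
qed

text \<open>
  Idempotency gives \<open>(ef)(fe) = efe\<close> and \<open>(fe)(ef) = fef\<close>, so the two excluded combinations say that
  \<open>ef\<close> and \<open>fe\<close> form a left zero pair or a right zero pair.
\<close>

lemma sandwiches_not_zero_pair:
  assumes "e \<in> idempotents S" "f \<in> idempotents S" "e \<otimes> f \<noteq> f \<otimes> e"
  shows "\<not> (e \<otimes> (f \<otimes> e) = e \<otimes> f \<and> f \<otimes> (e \<otimes> f) = f \<otimes> e)"
    and "\<not> (e \<otimes> (f \<otimes> e) = f \<otimes> e \<and> f \<otimes> (e \<otimes> f) = e \<otimes> f)"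
proof -
  have ef: "e \<in> carrier S" "f \<in> carrier S" "e \<otimes> e = e" "f \<otimes> f = f"
    using assms by (auto simp: idempotents_def)
  then have closed: "e \<otimes> f \<in> carrier S" "f \<otimes> e \<in> carrier S" by (simp_all add: m_closed)
  have prods: "(e \<otimes> f) \<otimes> (f \<otimes> e) = e \<otimes> (f \<otimes> e)" "(f \<otimes> e) \<otimes> (e \<otimes> f) = f \<otimes> (e \<otimes> f)"
    using ef closed m_assoc[of e f "f \<otimes> e"] m_assoc[of f e "e \<otimes> f"]
      m_assoc[of f f e] m_assoc[of e e f] by simp_all
  show "\<not> (e \<otimes> (f \<otimes> e) = e \<otimes> f \<and> f \<otimes> (e \<otimes> f) = f \<otimes> e)"
    using left_zero_pair_eq[OF closed] prods assms(3) by auto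
  show "\<not> (e \<otimes> (f \<otimes> e) = f \<otimes> e \<and> f \<otimes> (e \<otimes> f) = e \<otimes> f)"
    using right_zero_pair_eq[OF closed] prods assms(3) by auto
qed

lemma noncommuting_idempotents_exist:
  assumes "\<not> adequate_semigroup S"
  obtains e f where "e \<in> idempotents S" "f \<in> idempotents S" "e \<otimes> f \<noteq> f \<otimes> e"
proof -
  have "abundant_semigroup S"
    by unfold_locales (blast dest: Lstar_unique_idempotent Rstar_unique_idempotent)+
  with assms that show thesis
    unfolding adequate_semigroup_def adequate_semigroup_axioms_def by blast
qed

lemma order4_presentation:
  assumes "order S = 4" "\<not> adequate_semigroup S"
  obtains e f where "e \<in> idempotents S" "f \<in> idempotents S"
    "distinct [e, f, e \<otimes> f, f \<otimes> e]" "carrier S = {e, f, e \<otimes> f, f \<otimes> e}"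
    "e \<otimes> (f \<otimes> e) = e \<otimes> f" "f \<otimes> (e \<otimes> f) = e \<otimes> f"
proof -
  obtain e f where ef: "e \<in> idempotents S" "f \<in> idempotents S" and ne: "e \<otimes> f \<noteq> f \<otimes> e"
    using noncommuting_idempotents_exist assms(2) by blast
  have closed: "e \<in> carrier S" "f \<in> carrier S" "e \<otimes> e = e"
    using ef by (auto simp: idempotents_def)
  have distinct: "distinct [e, f, e \<otimes> f, f \<otimes> e]"
    using product_of_noncommuting_idempotents[OF ef ne]
      product_of_noncommuting_idempotents[OF ef(2,1) ne[symmetric]] ne closed by auto
  have "finite (carrier S)"
    using assms(1) by (auto simp: order_def intro: card_ge_0_finite)
  moreover have "{e, f, e \<otimes> f, f \<otimes> e} \<subseteq> carrier S"
    using closed by (auto intro: m_closed)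
  moreover have "card {e, f, e \<otimes> f, f \<otimes> e} = card (carrier S)"
    using distinct_card[OF distinct] assms(1) by (simp add: order_def)
  ultimately have carrier: "carrier S = {e, f, e \<otimes> f, f \<otimes> e}"
    using card_subset_eq by metis
  have "e \<otimes> (f \<otimes> e) \<in> {e \<otimes> f, f \<otimes> e}"
    using sandwich_of_noncommuting_idempotents[OF ef ne] carrier closed
      m_closed[of e "f \<otimes> e"] m_closed[of f e] by blast
  moreover have "f \<otimes> (e \<otimes> f) \<in> {e \<otimes> f, f \<otimes> e}"
    using sandwich_of_noncommuting_idempotents[OF ef(2,1) ne[symmetric]] carrier closed
      m_closed[of f "e \<otimes> f"] m_closed[of e f] by blast
  ultimately consider "e \<otimes> (f \<otimes> e) = e \<otimes> f" "f \<otimes> (e \<otimes> f) = e \<otimes> f"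
    | "e \<otimes> (f \<otimes> e) = f \<otimes> e" "f \<otimes> (e \<otimes> f) = f \<otimes> e"
    using sandwiches_not_zero_pair[OF ef ne] by blast
  then show thesis
  proof cases
    case 1
    with that ef distinct carrier show thesis by blast
  next
    case 2
    \<comment> \<open>Here \<open>fe\<close> is the zero, so the two idempotents exchange roles.\<close>
    show thesis
      by (rule that[of f e]) (use ef distinct carrier 2 in auto)
  qed
qed

end


section \<open>The four-element example\<close>

text \<open>
  The semigroup of the \<open>2 \<times> 2\<close> matrices \<open>e = (1 0; 0 0)\<close>, \<open>f = (0 0; 1 1)\<close>, \<open>fe = (0 0; 1 0)\<close> and
  \<open>ef = 0\<close>, coded as \<open>1\<close>, \<open>2\<close>, \<open>3\<close> and \<open>0\<close>.
\<close>

definition zero_product_mult :: "nat \<Rightarrow> nat \<Rightarrow> nat" where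
  "zero_product_mult x y =
    (if x = y \<and> x \<in> {1, 2} then x else if (x, y) \<in> {(2, 1), (2, 3), (3, 1)} then 3 else 0)"

definition zero_product_semigroup :: "nat monoid" where
  "zero_product_semigroup = \<lparr>carrier = {0, 1, 2, 3}, mult = zero_product_mult, one = 0\<rparr>"

lemma zero_product_carrier: "carrier zero_product_semigroup = {0, 1, 2, 3}"
  and zero_product_times: "mult zero_product_semigroup = zero_product_mult"
  by (simp_all add: zero_product_semigroup_def)

lemma zero_product_table:
  "zero_product_mult 0 x = 0" "zero_product_mult x 0 = 0"
  "zero_product_mult 1 1 = 1" "zero_product_mult 1 2 = 0" "zero_product_mult 1 3 = 0"
  "zero_product_mult 2 1 = 3" "zero_product_mult 2 2 = 2" "zero_product_mult 2 3 = 3"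
  "zero_product_mult 3 1 = 3" "zero_product_mult 3 2 = 0" "zero_product_mult 3 3 = 0"
  by (auto simp: zero_product_mult_def)

lemma semigroup_zero_product: "semigroup_struct zero_product_semigroup"
proof
  fix x y
  assume "x \<in> carrier zero_product_semigroup" "y \<in> carrier zero_product_semigroup"
  then show "x \<otimes>\<^bsub>zero_product_semigroup\<^esub> y \<in> carrier zero_product_semigroup"
    by (simp add: zero_product_carrier zero_product_times zero_product_mult_def)
next
  fix x y z
  assume "x \<in> carrier zero_product_semigroup" "y \<in> carrier zero_product_semigroup"
    "z \<in> carrier zero_product_semigroup"
  then show "x \<otimes>\<^bsub>zero_product_semigroup\<^esub> y \<otimes>\<^bsub>zero_product_semigroup\<^esub> z
      = x \<otimes>\<^bsub>zero_product_semigroup\<^esub> (y \<otimes>\<^bsub>zero_product_semigroup\<^esub> z)"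
    unfolding zero_product_carrier zero_product_times
    by (elim insertE emptyE; hypsubst) (simp_all add: zero_product_table del: One_nat_def)
qed

lemma idempotents_zero_product: "idempotents zero_product_semigroup = {0, 1, 2}"
proof -
  have "x \<in> idempotents zero_product_semigroup \<longleftrightarrow> x \<in> {0, 1, 2}" for x
    unfolding idempotents_def zero_product_carrier zero_product_times
    by (auto simp: zero_product_table simp del: One_nat_def)
  then show ?thesis by blast
qed

lemma adjoin_one_zero_product:
  "carrier (adjoin_one zero_product_semigroup) = {None, Some 0, Some 1, Some 2, Some 3}"
  "mult (adjoin_one zero_product_semigroup) = option_mult zero_product_mult"
proof -
  have "\<not> has_identity zero_product_semigroup"
    unfolding has_identity_def is_identity_def zero_product_carrier zero_product_times
    by (simp add: conj_disj_distribR ex_disj_distrib zero_product_table del: One_nat_def)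
  then show "carrier (adjoin_one zero_product_semigroup) = {None, Some 0, Some 1, Some 2, Some 3}"
    by (simp add: adjoin_one_def zero_product_semigroup_def)
  show "mult (adjoin_one zero_product_semigroup) = option_mult zero_product_mult"
    by (simp add: adjoin_one_def zero_product_semigroup_def)
qed

lemma Lstar_zero_product:
  "(s, t) \<in> Lstar zero_product_semigroup \<longleftrightarrow> (s, t) \<in> {(0, 0), (1, 1), (1, 3), (3, 1), (3, 3), (2, 2)}"
proof (cases "s \<in> {0, 1, 2, 3} \<and> t \<in> {0, 1, 2, 3}")
  case True
  then show ?thesis
    by (elim conjE insertE emptyE; hypsubst)
      (simp_all add: Lstar_def adjoin_one_zero_product zero_product_carrier zero_product_table del: One_nat_def)
next
  case False
  then show ?thesis
    by (auto simp: Lstar_def zero_product_semigroup_def)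
qed

lemma Rstar_zero_product:
  "(s, t) \<in> Rstar zero_product_semigroup \<longleftrightarrow> (s, t) \<in> {(0, 0), (1, 1), (2, 2), (2, 3), (3, 2), (3, 3)}"
proof (cases "s \<in> {0, 1, 2, 3} \<and> t \<in> {0, 1, 2, 3}")
  case True
  then show ?thesis
    by (elim conjE insertE emptyE; hypsubst)
      (simp_all add: Rstar_def adjoin_one_zero_product zero_product_carrier zero_product_table del: One_nat_def)
next
  case False
  then show ?thesis
    by (auto simp: Rstar_def zero_product_semigroup_def)
qed

lemma amiable_zero_product: "amiable_semigroup zero_product_semigroup"
proof (intro amiable_semigroup.intro semigroup_zero_product amiable_semigroup_axioms.intro)
  fix C
  assume "C \<in> carrier zero_product_semigroup // Rstar zero_product_semigroup"
  then show "\<exists>!e. e \<in> C \<and> e \<in> idempotents zero_product_semigroup"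
  proof (rule quotientE)
    fix s
    assume C: "C = Rstar zero_product_semigroup `` {s}" and "s \<in> carrier zero_product_semigroup"
    then have "s = 0 \<or> s = 1 \<or> s = 2 \<or> s = 3"
      by (simp add: zero_product_semigroup_def)
    then show ?thesis
      \<comment> \<open>The only element outside the idempotents is \<open>fe = 3\<close>, whose \<open>\<R>\<^sup>*\<close>-class contains \<open>f = 2\<close>.\<close>
      unfolding C idempotents_zero_product Image_singleton_iff Rstar_zero_product
      by (intro ex1I[of _ "if s = 3 then 2 else s"]) auto
  qed
next
  fix C
  assume "C \<in> carrier zero_product_semigroup // Lstar zero_product_semigroup"
  then show "\<exists>!e. e \<in> C \<and> e \<in> idempotents zero_product_semigroup"
  proof (rule quotientE)
    fix s
    assume C: "C = Lstar zero_product_semigroup `` {s}" and "s \<in> carrier zero_product_semigroup"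
    then have "s = 0 \<or> s = 1 \<or> s = 2 \<or> s = 3"
      by (simp add: zero_product_semigroup_def)
    then show ?thesis
      \<comment> \<open>The \<open>\<L>\<^sup>*\<close>-class of \<open>fe = 3\<close> contains \<open>e = 1\<close>.\<close>
      unfolding C idempotents_zero_product Image_singleton_iff Lstar_zero_product
      by (intro ex1I[of _ "if s = 3 then 1 else s"]) auto
  qed
qed

lemma not_adequate_zero_product: "\<not> adequate_semigroup zero_product_semigroup"
proof
  assume "adequate_semigroup zero_product_semigroup"
  moreover have "1 \<in> idempotents zero_product_semigroup" "2 \<in> idempotents zero_product_semigroup"
    by (simp_all add: idempotents_zero_product)
  ultimately have "zero_product_mult 1 2 = zero_product_mult 2 1"
    using adequate_semigroup.idempotents_commute[of zero_product_semigroup 1 2]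
    by (simp add: zero_product_semigroup_def)
  then show False
    unfolding zero_product_table by simp
qed


section \<open>Uniqueness\<close>

text \<open>
  The equations \<open>efe = ef = fef\<close> and associativity determine the whole multiplication table, in which
  \<open>z = ef\<close> turns out to be the zero and \<open>n = fe\<close> has square \<open>z\<close>.
\<close>

lemma (in semigroup_struct) iso_zero_product:
  assumes ef: "e \<in> idempotents S" "f \<in> idempotents S"
    and distinct: "distinct [e, f, e \<otimes> f, f \<otimes> e]"
    and carrier: "carrier S = {e, f, e \<otimes> f, f \<otimes> e}"
    and efe: "e \<otimes> (f \<otimes> e) = e \<otimes> f" and fef: "f \<otimes> (e \<otimes> f) = e \<otimes> f"
  shows "S \<cong> zero_product_semigroup"
proof -
  define z n where "z = e \<otimes> f" and "n = f \<otimes> e"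
  have idem: "e \<otimes> e = e" "f \<otimes> f = f" and closed: "e \<in> carrier S" "f \<in> carrier S"
    using ef by (auto simp: idempotents_def)
  have zn_closed: "z \<in> carrier S" "n \<in> carrier S"
    using closed by (simp_all add: z_def n_def m_closed)
  have gen: "e \<otimes> f = z" "f \<otimes> e = n" "e \<otimes> n = z" "f \<otimes> z = z"
    using efe fef by (simp_all add: z_def n_def)
  have "e \<otimes> z = z" "z \<otimes> f = z"
    using m_assoc[of e e f] m_assoc[of e f f] closed idem gen by simp_all
  moreover have "f \<otimes> n = n" "n \<otimes> e = n"
    using m_assoc[of f f e] m_assoc[of f e e] closed idem gen by simp_all
  moreover have "z \<otimes> e = z" "n \<otimes> f = z"
    using m_assoc[of e f e] m_assoc[of f e f] closed gen by simp_all
  ultimately have acts: "e \<otimes> z = z" "z \<otimes> f = z" "f \<otimes> n = n" "n \<otimes> e = n" "z \<otimes> e = z" "n \<otimes> f = z"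
    by blast+
  have "z \<otimes> x = e \<otimes> (f \<otimes> x)" "n \<otimes> x = f \<otimes> (e \<otimes> x)" if "x \<in> carrier S" for x
    using that closed m_assoc[of e f x] m_assoc[of f e x] gen by simp_all
  then have rest: "z \<otimes> z = z" "z \<otimes> n = z" "n \<otimes> z = z" "n \<otimes> n = z"
    using zn_closed gen acts by simp_all
  define \<phi> where "\<phi> x = (if x = e then 1 else if x = f then 2 else if x = n then 3 else 0 :: nat)" for x
  have dist: "e \<noteq> f" "e \<noteq> z" "e \<noteq> n" "f \<noteq> z" "f \<noteq> n" "z \<noteq> n"
    using distinct by (auto simp: z_def n_def)
  have \<phi>: "\<phi> e = 1" "\<phi> f = 2" "\<phi> z = 0" "\<phi> n = 3"
    using dist by (auto simp: \<phi>_def)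
  have car: "carrier S = {e, f, z, n}" using carrier by (simp add: z_def n_def)
  have "\<phi> \<in> hom S zero_product_semigroup"
    by (rule homI)
      (auto simp: car \<phi> idem gen acts rest zero_product_semigroup_def zero_product_mult_def)
  moreover have "bij_betw \<phi> (carrier S) (carrier zero_product_semigroup)"
    by (auto simp: bij_betw_def inj_on_def car \<phi> zero_product_semigroup_def)
  ultimately show ?thesis
    by (auto simp: is_iso_def iso_def)
qed

theorem theorem4:
  shows "\<exists>S :: nat monoid.
    amiable_semigroup S \<and> order S = 4 \<and> \<not> adequate_semigroup S \<and>
    (\<forall>T :: 'a monoid.
      amiable_semigroup T \<and> order T = 4 \<and> \<not> adequate_semigroup T \<longrightarrow> T \<cong> S)"
proof (intro exI[of _ zero_product_semigroup] conjI allI impI)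
  show "amiable_semigroup zero_product_semigroup" by (rule amiable_zero_product)
  show "order zero_product_semigroup = 4" by (simp add: order_def zero_product_semigroup_def)
  show "\<not> adequate_semigroup zero_product_semigroup" by (rule not_adequate_zero_product)
next
  fix T :: "'a monoid"
  assume T: "amiable_semigroup T \<and> order T = 4 \<and> \<not> adequate_semigroup T"
  then interpret T: amiable_semigroup T by simp
  from T obtain e f where "e \<in> idempotents T" "f \<in> idempotents T"
    "distinct [e, f, e \<otimes>\<^bsub>T\<^esub> f, f \<otimes>\<^bsub>T\<^esub> e]" "carrier T = {e, f, e \<otimes>\<^bsub>T\<^esub> f, f \<otimes>\<^bsub>T\<^esub> e}"
    "e \<otimes>\<^bsub>T\<^esub> (f \<otimes>\<^bsub>T\<^esub> e) = e \<otimes>\<^bsub>T\<^esub> f" "f \<otimes>\<^bsub>T\<^esub> (e \<otimes>\<^bsub>T\<^esub> f) = e \<otimes>\<^bsub>T\<^esub> f"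
    using T.order4_presentation by blast
  then show "T \<cong> zero_product_semigroup" by (rule T.iso_zero_product)
qed

end
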